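(* Let $\mathbb{F}_2$ be the free group on two free generators $a,b$, and suppose $A\subset\mathbb{F}_2$ satisfies $$\varlimsup_{m\to\infty}\frac1m\sum_{n=1}^m\frac{|A\cap S_n|}{|S_n|}>0.$$ Then there exists a finite set $F\subset\mathbb{F}_2$ such that $FAA^{-1}$ contains a right translate of every finite subset of $\mathbb{F}_2$, i.e. for every finite $K\subset\mathbb{F}_2$ there exists $g\in\mathbb{F}_2$ with $Kg\subset FAA^{-1}$.
   Context: $S_n$ is the sphere of radius $n$ in $\mathbb{F}_2$: the set of elements whose reduced form as a word in $a,b,a^{-1},b^{-1}$ has length exactly $n$. $FAA^{-1}=\{f a_1a_2^{-1}:f\in F,\ a_1,a_2\in A\}$. *)

theory Defs
  imports "HOL-Algebra.Coset" "HOL-Library.Extended_Real"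
begin

datatype generator = Gen_a | Gen_b

text \<open>The letter \<open>(s, True)\<close> stands for the generator \<open>s\<close>, and \<open>(s, False)\<close> for its inverse.\<close>

type_synonym letter = "generator \<times> bool"

definition flip :: "letter \<Rightarrow> letter" where
  "flip x = (fst x, \<not> snd x)"

definition reduced :: "letter list \<Rightarrow> bool" where
  "reduced w \<longleftrightarrow> successively (\<lambda>x y. y \<noteq> flip x) w"

fun cons_red :: "letter \<Rightarrow> letter list \<Rightarrow> letter list" where
  "cons_red x [] = [x]"
| "cons_red x (y # ys) = (if y = flip x then ys else x # y # ys)"

text \<open>The free group on two generators, modelled on the reduced words: the product is
  concatenation followed by free reduction. Theorem \<open>F2_free\<close> below is its universal property.\<close>

definition F2 :: "letter list monoid" where
  "F2 = \<lparr>carrier = {w. reduced w}, mult = (\<lambda>u v. foldr cons_red u v), one = []\<rparr>"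

definition word_sphere :: "nat \<Rightarrow> letter list set" where
  "word_sphere n = {w \<in> carrier F2. length w = n}"

lemma flip_flip [simp]: "flip (flip x) = x"
  by (simp add: flip_def)

lemma flip_neq [simp]: "flip x \<noteq> x" "x \<noteq> flip x"
  by (auto simp: flip_def prod_eq_iff)

lemma reduced_Nil [simp]: "reduced []"
  by (simp add: reduced_def)

lemma reduced_Cons:
  "reduced (x # w) \<longleftrightarrow> (w = [] \<or> hd w \<noteq> flip x) \<and> reduced w"
  by (auto simp: reduced_def successively_Cons)

lemma reduced_cons_red: "reduced w \<Longrightarrow> reduced (cons_red x w)"
  by (cases w) (auto simp: reduced_Cons)

lemma reduced_foldr: "reduced v \<Longrightarrow> reduced (foldr cons_red u v)"
  by (induction u) (auto intro: reduced_cons_red)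

lemma cons_red_flip: "reduced w \<Longrightarrow> cons_red x (cons_red (flip x) w) = w"
proof (cases w)
  case (Cons y ys)
  assume "reduced w"
  with Cons show ?thesis by (cases ys) (auto simp: reduced_Cons)
qed simp

lemma foldr_cons_red:
  assumes "reduced w"
  shows "foldr cons_red (cons_red x v) w = cons_red x (foldr cons_red v w)"
  using assms by (cases v) (auto simp: cons_red_flip reduced_foldr)

lemma foldr_cons_red_assoc:
  "reduced w \<Longrightarrow> foldr cons_red (foldr cons_red u v) w = foldr cons_red u (foldr cons_red v w)"
  by (induction u) (auto simp: foldr_cons_red)

lemma foldr_cons_red_Nil: "reduced u \<Longrightarrow> foldr cons_red u [] = u"
proof (induction u)
  case (Cons x u)
  then show ?case by (cases u) (auto simp: reduced_Cons)
qed simp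

lemma foldr_cons_red_inverse:
  "reduced w \<Longrightarrow> foldr cons_red (rev (map flip u)) (foldr cons_red u w) = w"
proof (induction u arbitrary: w)
  case (Cons x u)
  have "cons_red (flip x) (cons_red x (foldr cons_red u w)) = foldr cons_red u w"
    using cons_red_flip[of "foldr cons_red u w" "flip x"] Cons.prems by (simp add: reduced_foldr)
  with Cons show ?case by simp
qed simp

lemma F2_simps:
  "carrier F2 = {w. reduced w}" "u \<otimes>\<^bsub>F2\<^esub> v = foldr cons_red u v" "\<one>\<^bsub>F2\<^esub> = []"
  by (simp_all add: F2_def)

theorem F2_group: "group F2"
proof (rule groupI)
  fix u assume "u \<in> carrier F2"
  then have u: "reduced u" by (simp add: F2_simps)
  let ?v = "foldr cons_red (rev (map flip u)) []"
  have "foldr cons_red ?v u = foldr cons_red (rev (map flip u)) (foldr cons_red u [])"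
    using u by (simp add: foldr_cons_red_assoc foldr_cons_red_Nil)
  also have "\<dots> = []" by (rule foldr_cons_red_inverse) simp
  finally show "\<exists>v\<in>carrier F2. v \<otimes>\<^bsub>F2\<^esub> u = \<one>\<^bsub>F2\<^esub>"
    by (intro bexI[of _ ?v]) (auto simp: F2_simps reduced_foldr)
qed (auto simp: F2_simps reduced_foldr foldr_cons_red_assoc)

theorem F2_free:
  fixes H (structure)
  assumes "group H" and pq: "p \<in> carrier H" "q \<in> carrier H"
  shows "\<exists>h\<in>hom F2 H. h [(Gen_a, True)] = p \<and> h [(Gen_b, True)] = q"
    and "\<lbrakk>h \<in> hom F2 H; h' \<in> hom F2 H; h [(Gen_a, True)] = h' [(Gen_a, True)];
          h [(Gen_b, True)] = h' [(Gen_b, True)]; w \<in> carrier F2\<rbrakk> \<Longrightarrow> h w = h' w"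
proof -
  interpret H: group H by fact
  interpret F: group F2 by (rule F2_group)
  define c where "c x = (let r = (case fst x of Gen_a \<Rightarrow> p | Gen_b \<Rightarrow> q) in
    if snd x then r else inv r)" for x
  define e where "e w = foldr (\<lambda>x y. c x \<otimes> y) w \<one>" for w
  have c [simp]: "c x \<in> carrier H" for x
    using pq by (auto simp: c_def Let_def split: generator.splits)
  have c_flip: "c x \<otimes> c (flip x) = \<one>" for x
    using pq by (auto simp: c_def flip_def Let_def split: generator.splits)
  have e_carrier [simp]: "e w \<in> carrier H" for w
    by (induction w) (auto simp: e_def)
  have e_Cons: "e (x # w) = c x \<otimes> e w" for x w
    by (simp add: e_def)
  have e_cons_red: "e (cons_red x w) = c x \<otimes> e w" for x w
  proof (cases w)
    case Nil
    then show ?thesis by (simp add: e_Cons)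
  next
    case (Cons y ys)
    have "c x \<otimes> (c (flip x) \<otimes> e ys) = e ys"
      by (simp add: H.m_assoc[symmetric] c_flip)
    with Cons show ?thesis by (simp add: e_Cons)
  qed
  have e_mult: "e (foldr cons_red u v) = e u \<otimes> e v" for u v
    by (induction u) (simp_all add: e_Cons e_cons_red H.m_assoc, simp add: e_def)
  have "e \<in> hom F2 H" by (auto simp: hom_def F2_simps e_mult)
  moreover have "e [(Gen_a, True)] = p" "e [(Gen_b, True)] = q"
    using pq by (simp_all add: e_def c_def)
  ultimately show "\<exists>h\<in>hom F2 H. h [(Gen_a, True)] = p \<and> h [(Gen_b, True)] = q"
    by blast
next
  interpret H: group H by fact
  interpret F: group F2 by (rule F2_group)
  assume h: "h \<in> hom F2 H" and h': "h' \<in> hom F2 H"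
    and a: "h [(Gen_a, True)] = h' [(Gen_a, True)]" and b: "h [(Gen_b, True)] = h' [(Gen_b, True)]"
    and w: "w \<in> carrier F2"
  interpret h: group_hom F2 H h using h by unfold_locales
  interpret h': group_hom F2 H h' using h' by unfold_locales
  have s: "[x] \<in> carrier F2" for x by (simp add: F2_simps reduced_Cons)
  have pos: "h [(s, True)] = h' [(s, True)]" for s using a b by (cases s) auto
  have inv: "inv\<^bsub>F2\<^esub> [(t, True)] = [(t, False)]" for t
    by (rule F.inv_equality) (auto simp: F2_simps reduced_Cons flip_def)
  have neg: "h [(t, False)] = h' [(t, False)]" for t
    using h.hom_inv[OF s, of "(t, True)"] h'.hom_inv[OF s, of "(t, True)"] pos[of t]
    by (simp add: inv)
  have letter: "h [x] = h' [x]" for x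
    by (cases x; cases "snd x") (auto simp: pos neg)
  from w show "h w = h' w"
  proof (induction w)
    case Nil
    then show ?case using h.hom_one h'.hom_one by (simp add: F2_simps)
  next
    case (Cons x w)
    then have w: "w \<in> carrier F2" and eq: "x # w = [x] \<otimes>\<^bsub>F2\<^esub> w"
      by (cases w; auto simp: F2_simps reduced_Cons)+
    show ?case unfolding eq using Cons.IH[OF w] w s letter by simp
  qed
qed

end

theory Submission
  imports "HOL-Complex_Analysis.Great_Picard" Defs
begin

text \<open>
  Along a suitable sequence the averaged sphere densities of the countably many sets \<open>F A\<close>
  (\<open>F\<close> finite) converge, to \<open>\<lambda>(F A)\<close> say, with \<open>\<lambda>(A) > 0\<close>. The limit is additive on disjoint sets,
  and it is stationary under the simple random walk, so that \<open>h(g) = \<lambda>(g A)\<close> is a bounded harmonic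
  function. Let \<open>d = sup h > 0\<close>, and choose \<open>F\<close> with \<open>\<lambda>(F A)\<close> within \<open>d/2\<close> of its
  supremum over all finite sets. A nonnegative harmonic function that is small at a point is small
  near this point; applied to \<open>d - h\<close> this yields, for each finite \<open>K\<close>, some \<open>g\<close> with
  \<open>h(k g) > d/2\<close> for all \<open>k \<in> K\<close>. Then \<open>k g A\<close> meets \<open>F A\<close>, as otherwise
  \<open>F \<union> {k g}\<close> would exceed the supremum; hence \<open>k g \<in> F A A\<^sup>-\<^sup>1\<close>.
\<close>

section \<open>Counting reduced words and their translates by letters\<close>

lemma UNIV_generator: "UNIV = {Gen_a, Gen_b}"
proof -
  have "s \<in> {Gen_a, Gen_b}" for s by (cases s) auto
  then show ?thesis by auto
qed

lemma card_generator [simp]: "CARD(generator) = 2"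
  by (simp add: UNIV_generator)

lemma card_letters: "CARD(letter) = 4"
  by simp

lemma finite_letters [simp]: "finite (X :: letter set)"
  by (rule finite_subset[of _ UNIV]) (auto intro!: card_ge_0_finite)

lemma card_letters_neq: "card {x :: letter. x \<noteq> y} = 3"
proof -
  have "{x :: letter. x \<noteq> y} = UNIV - {y}" by auto
  then show ?thesis by (simp only: card_Diff_singleton[OF UNIV_I] card_letters)
qed

lemma countable_words: "countable (W :: letter list set)"
proof -
  have "countable (lists (UNIV :: letter set))"
    by (intro countable_lists countable_finite finite_letters)
  then show ?thesis by (rule countable_subset[rotated]) auto
qed

lemma word_sphere_altdef: "word_sphere n = {w. reduced w \<and> length w = n}"
  by (auto simp: word_sphere_def F2_simps)

lemma finite_word_sphere [simp]: "finite (word_sphere n)"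
  by (rule finite_subset[OF _ finite_lists_length_eq[OF finite_letters[of UNIV], of n]])
     (auto simp: word_sphere_altdef)

text \<open>A nonempty reduced word stays reduced when any letter but the inverse of its first one
  is prepended. The empty word admits all four letters, so the recursion starts at length 1.\<close>

lemma card_word_sphere_Suc_Suc: "card (word_sphere (Suc (Suc n))) = 3 * card (word_sphere (Suc n))"
proof -
  let ?D = "SIGMA w : word_sphere (Suc n). {x. x \<noteq> flip (hd w)}"
  have "bij_betw (\<lambda>(w, x). x # w) ?D (word_sphere (Suc (Suc n)))"
  proof (rule bij_betw_imageI)
    show "inj_on (\<lambda>(w, x). x # w) ?D" by (auto simp: inj_on_def)
    have "x \<noteq> flip y \<longleftrightarrow> y \<noteq> flip x" for x y by auto
    then have "x # w \<in> word_sphere (Suc (Suc n)) \<longleftrightarrow> (w, x) \<in> ?D" for x w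
      by (auto simp: word_sphere_altdef reduced_Cons)
    moreover have "v \<in> word_sphere (Suc (Suc n)) \<Longrightarrow> \<exists>x w. v = x # w" for v
      by (cases v) (auto simp: word_sphere_altdef)
    ultimately show "(\<lambda>(w, x). x # w) ` ?D = word_sphere (Suc (Suc n))"
      by (auto simp: image_iff) blast
  qed
  then have "card (word_sphere (Suc (Suc n))) = card ?D"
    by (simp add: bij_betw_same_card)
  also have "\<dots> = (\<Sum>w\<in>word_sphere (Suc n). 3)"
    by (subst card_SigmaI) (simp_all add: card_letters_neq)
  finally show ?thesis by simp
qed

lemma card_word_sphere_Suc: "card (word_sphere (Suc n)) = 4 * 3 ^ n"
proof (induction n)
  case 0
  have "word_sphere (Suc 0) = (\<lambda>x. [x]) ` UNIV"
    by (auto simp: word_sphere_altdef length_Suc_conv reduced_Cons)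
  then show ?case by (simp add: card_image inj_on_def card_letters)
next
  case (Suc n)
  then show ?case by (simp add: card_word_sphere_Suc_Suc)
qed

lemma length_cons_red:
  "w \<noteq> [] \<Longrightarrow> length (cons_red x w) = (if x = flip (hd w) then length w - 1 else Suc (length w))"
  by (cases w) auto

lemma inj_on_cons_red:
  assumes "\<And>w. w \<in> B \<Longrightarrow> reduced w"
  shows "inj_on (cons_red x) B"
  by (metis assms cons_red_flip flip_flip inj_onI)

text \<open>Double counting of pairs of a word and a letter: left multiplication by a letter changes
  the length by exactly one. Three letters lengthen a nonempty word and one shortens it; taking
  radius at least 2 keeps the empty word out of the count.\<close>

lemma sum_card_letter_translates:
  assumes B: "\<And>w. w \<in> B \<Longrightarrow> reduced w"
  shows "(\<Sum>x\<in>UNIV. card (cons_red x ` B \<inter> word_sphere (Suc (Suc n)))) =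
         3 * card (B \<inter> word_sphere (Suc n)) + card (B \<inter> word_sphere (Suc (Suc (Suc n))))"
proof -
  let ?S = "B \<inter> word_sphere (Suc n)" and ?T = "B \<inter> word_sphere (Suc (Suc (Suc n)))"
  let ?P = "\<lambda>w x. length (cons_red x w) = Suc (Suc n)"
  have "card (cons_red x ` B \<inter> word_sphere (Suc (Suc n))) = card {w \<in> ?S \<union> ?T. ?P w x}" for x
  proof -
    have "cons_red x ` B \<inter> word_sphere (Suc (Suc n)) = cons_red x ` {w \<in> B. ?P w x}"
      using B by (auto simp: word_sphere_altdef reduced_cons_red)
    \<comment> \<open>Only the two neighbouring spheres can be moved onto the sphere of radius
      \<open>Suc (Suc n)\<close>.\<close>
    also have "{w \<in> B. ?P w x} = {w \<in> ?S \<union> ?T. ?P w x}"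
    proof -
      have "length w = Suc n \<or> length w = Suc (Suc (Suc n))" if "?P w x" for w
        using that by (cases w) (auto split: if_splits)
      then show ?thesis using B by (auto simp: word_sphere_altdef)
    qed
    finally have "cons_red x ` B \<inter> word_sphere (Suc (Suc n)) = cons_red x ` {w \<in> ?S \<union> ?T. ?P w x}" .
    moreover have "inj_on (cons_red x) {w \<in> ?S \<union> ?T. ?P w x}"
      by (rule inj_on_cons_red) (auto dest: B)
    ultimately show ?thesis by (simp only: card_image)
  qed
  then have "(\<Sum>x\<in>UNIV. card (cons_red x ` B \<inter> word_sphere (Suc (Suc n)))) =
      (\<Sum>x\<in>UNIV. card {w \<in> ?S \<union> ?T. ?P w x})"
    by simp
  also have "\<dots> = (\<Sum>w\<in>?S \<union> ?T. card {x \<in> UNIV. ?P w x})"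
    by (rule sum_multicount_gen[symmetric]) auto
  also have "\<dots> = (\<Sum>w\<in>?S. card {x \<in> UNIV. ?P w x}) + (\<Sum>w\<in>?T. card {x \<in> UNIV. ?P w x})"
    by (rule sum.union_disjoint) (simp, simp, auto simp: word_sphere_altdef)
  also have "(\<Sum>w\<in>?S. card {x \<in> UNIV. ?P w x}) = (\<Sum>w\<in>?S. 3)"
  proof (rule sum.cong)
    fix w assume "w \<in> ?S"
    then have "length w = Suc n" "w \<noteq> []" by (auto simp: word_sphere_altdef)
    then have "{x \<in> UNIV. ?P w x} = {x. x \<noteq> flip (hd w)}"
      by (auto simp: length_cons_red split: if_splits)
    then show "card {x \<in> UNIV. ?P w x} = 3" by (simp add: card_letters_neq)
  qed simp
  also have "(\<Sum>w\<in>?T. card {x \<in> UNIV. ?P w x}) = (\<Sum>w\<in>?T. 1)"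
  proof (rule sum.cong)
    fix w assume "w \<in> ?T"
    then have "length w = Suc (Suc (Suc n))" "w \<noteq> []" by (auto simp: word_sphere_altdef)
    then have "{x \<in> UNIV. ?P w x} = {flip (hd w)}"
      by (auto simp: length_cons_red split: if_splits)
    then show "card {x \<in> UNIV. ?P w x} = 1" by simp
  qed simp
  finally show ?thesis by simp
qed

section \<open>Sphere densities and their averages\<close>

definition sphere_density :: "letter list set \<Rightarrow> nat \<Rightarrow> real" where
  "sphere_density B n = real (card (B \<inter> word_sphere n)) / real (card (word_sphere n))"

definition mean_density :: "nat \<Rightarrow> letter list set \<Rightarrow> real" where
  "mean_density m B = 1 / real m * (\<Sum>n=1..m. sphere_density B n)"

lemma sphere_density_nonneg: "0 \<le> sphere_density B n"
  by (simp add: sphere_density_def)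

lemma sphere_density_le_1: "sphere_density B n \<le> 1"
proof -
  have "card (B \<inter> word_sphere n) \<le> card (word_sphere n)" by (rule card_mono) auto
  then show ?thesis unfolding sphere_density_def by (intro divide_le_eq_1[THEN iffD2]) linarith
qed

lemma sphere_density_disjoint_Un:
  assumes "B \<inter> C = {}"
  shows "sphere_density (B \<union> C) n = sphere_density B n + sphere_density C n"
proof -
  have "card ((B \<union> C) \<inter> word_sphere n) = card (B \<inter> word_sphere n) + card (C \<inter> word_sphere n)"
    using assms by (subst Int_Un_distrib2, subst card_Un_disjoint) auto
  then show ?thesis by (simp add: sphere_density_def add_divide_distrib)
qed

lemma mean_density_nonneg: "0 \<le> mean_density m B"
  by (simp add: mean_density_def sum_nonneg sphere_density_nonneg)

lemma mean_density_le_1: "mean_density m B \<le> 1"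
proof -
  have "(\<Sum>n=1..m. sphere_density B n) \<le> (\<Sum>n=1..m. 1)"
    by (intro sum_mono sphere_density_le_1)
  then show ?thesis by (cases "m = 0") (simp_all add: mean_density_def)
qed

lemma mean_density_disjoint_Un:
  "B \<inter> C = {} \<Longrightarrow> mean_density m (B \<union> C) = mean_density m B + mean_density m C"
  by (simp add: mean_density_def sphere_density_disjoint_Un sum.distrib distrib_left add_divide_distrib)

text \<open>Consecutive spheres of positive radius grow by the factor 3, so passing from counts to
  densities turns the weights 3 and 1 into 1 and 3.\<close>

lemma sum_sphere_density_letter_translates:
  assumes "\<And>w. w \<in> B \<Longrightarrow> reduced w"
  shows "(\<Sum>x\<in>UNIV. sphere_density (cons_red x ` B) (Suc (Suc n))) =
         sphere_density B (Suc n) + 3 * sphere_density B (Suc (Suc (Suc n)))"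
  using arg_cong[OF sum_card_letter_translates[of B n, OF assms], of real]
  by (simp add: sphere_density_def card_word_sphere_Suc sum_divide_distrib[symmetric] field_simps)

text \<open>Approximate stationarity under the simple random walk: the weights 1 and 3 add up to 4,
  so summing over the radii telescopes and leaves boundary terms only.\<close>

lemma sum_mean_density_letter_translates:
  assumes "\<And>w. w \<in> B \<Longrightarrow> reduced w"
  shows "\<bar>(\<Sum>x\<in>UNIV. mean_density m (cons_red x ` B)) - 4 * mean_density m B\<bar> \<le> 20 / real m"
proof (cases m)
  \<comment> \<open>Division by zero yields 0, so both sides vanish.\<close>
  case 0
  then show ?thesis by (simp add: mean_density_def)
next
  case (Suc p)
  define u where "u = sphere_density B"
  define T where "T n = (\<Sum>x\<in>UNIV. sphere_density (cons_red x ` B) n)" for n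
  have u: "0 \<le> u n" "u n \<le> 1" for n
    by (simp_all add: u_def sphere_density_nonneg sphere_density_le_1)
  have T1: "0 \<le> T 1" "T 1 \<le> 4"
  proof -
    have "T 1 \<le> (\<Sum>x\<in>(UNIV :: letter set). 1)"
      unfolding T_def by (intro sum_mono sphere_density_le_1)
    then show "T 1 \<le> 4" by (simp add: card_letters)
  qed (auto simp: T_def sum_nonneg sphere_density_nonneg)
  have step: "T (Suc (Suc n)) = u (Suc n) + 3 * u (Suc (Suc (Suc n)))" for n
    using sum_sphere_density_letter_translates[of B n, OF assms] by (simp add: T_def u_def)
  \<comment> \<open>Here \<open>T 1\<close> remains because \<open>step\<close> only covers radii
    from 2 on. The right-hand side has absolute value at most 7, so the bound 20 is
    generous.\<close>
  have "(\<Sum>n=1..Suc p. T n) - 4 * (\<Sum>n=1..Suc p. u n) =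
      T 1 - u (Suc p) - 3 * u 1 - 3 * u 2 + 3 * u (Suc (Suc p))"
  proof (induction p)
    case 0
    then show ?case by (simp add: numeral_2_eq_2)
  next
    case (Suc p)
    then show ?case using step[of p] by (simp add: algebra_simps)
  qed
  then have "\<bar>(\<Sum>n=1..m. T n) - 4 * (\<Sum>n=1..m. u n)\<bar> \<le> 20"
    using T1 u[of "Suc p"] u[of 1] u[of 2] u[of "Suc (Suc p)"] Suc by simp
  moreover have "(\<Sum>x\<in>UNIV. mean_density m (cons_red x ` B)) - 4 * mean_density m B =
      ((\<Sum>n=1..m. T n) - 4 * (\<Sum>n=1..m. u n)) / real m"
    by (simp add: mean_density_def T_def u_def sum_distrib_left[symmetric] sum_divide_distrib[symmetric]
        diff_divide_distrib sum.swap[of _ UNIV])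
  ultimately show ?thesis
    by (simp add: divide_right_mono)
qed

section \<open>Harmonic functions and the limit density\<close>

text \<open>A Harnack inequality: \<open>d - h\<close> is nonnegative and harmonic, so its value at
  one neighbour is at most the sum over all four, which is 4 times the value at the point. Each
  letter of \<open>k\<close> thus costs a factor 4.\<close>

lemma harmonic_near_supremum:
  fixes h :: "letter list \<Rightarrow> real"
  assumes harmonic: "\<And>w. reduced w \<Longrightarrow> (\<Sum>x\<in>UNIV. h (cons_red x w)) = 4 * h w"
    and le: "\<And>w. reduced w \<Longrightarrow> h w \<le> d"
    and g: "reduced g"
  shows "d - h (foldr cons_red k g) \<le> 4 ^ length k * (d - h g)"
proof (induction k)
  case (Cons x k)
  define w where "w = foldr cons_red k g"
  have w: "reduced w" unfolding w_def using g by (rule reduced_foldr)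
  have "d - h (cons_red x w) \<le> (\<Sum>y\<in>UNIV. d - h (cons_red y w))"
    by (rule member_le_sum) (auto simp: le w reduced_cons_red)
  also have "\<dots> = 4 * (d - h w)"
    by (simp add: sum_subtractf harmonic w card_letters)
  also have "\<dots> \<le> 4 * (4 ^ length k * (d - h g))"
    using Cons.IH by (simp add: w_def)
  finally show ?case by (simp add: w_def)
qed simp

text \<open>Assuming the limits along \<open>r\<close> separates the argument in the group from the
  compactness argument that supplies them.\<close>

lemma thick_product_of_limit_density:
  fixes A :: "letter list set"
  assumes A: "A \<subseteq> carrier F2"
    and r: "strict_mono (r :: nat \<Rightarrow> nat)"
    and lim: "\<And>F. finite F \<Longrightarrow> F \<subseteq> carrier F2 \<Longrightarrow> (\<lambda>n. mean_density (r n) (F <#>\<^bsub>F2\<^esub> A)) \<longlonglongrightarrow> L F"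
    and pos: "L {\<one>\<^bsub>F2\<^esub>} > 0"
  shows "\<exists>F. finite F \<and> F \<subseteq> carrier F2 \<and>
           (\<forall>K. finite K \<and> K \<subseteq> carrier F2 \<longrightarrow>
             (\<exists>g\<in>carrier F2. K #>\<^bsub>F2\<^esub> g \<subseteq> F <#>\<^bsub>F2\<^esub> A <#>\<^bsub>F2\<^esub> set_inv\<^bsub>F2\<^esub> A))"
proof -
  interpret group F2 by (rule F2_group)
  define h where "h g = L {g}" for g
  have redA: "reduced a" if "a \<in> A" for a using A that by (auto simp: F2_simps)
  have h_lim: "(\<lambda>n. mean_density (r n) ({g} <#>\<^bsub>F2\<^esub> A)) \<longlonglongrightarrow> h g" if "reduced g" for g
    unfolding h_def using that by (intro lim) (auto simp: F2_simps)
  have L_le_1: "L F \<le> 1" if "finite F" "F \<subseteq> carrier F2" for F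
    by (rule LIMSEQ_le_const2[OF lim[OF that]]) (auto intro: mean_density_le_1)
  have harmonic: "(\<Sum>x\<in>UNIV. h (cons_red x g)) = 4 * h g" if g: "reduced g" for g
  proof -
    let ?e = "\<lambda>n. (\<Sum>x\<in>UNIV. mean_density (r n) ({cons_red x g} <#>\<^bsub>F2\<^esub> A))
        - 4 * mean_density (r n) ({g} <#>\<^bsub>F2\<^esub> A)"
    have "?e \<longlonglongrightarrow> (\<Sum>x\<in>UNIV. h (cons_red x g)) - 4 * h g"
      by (intro tendsto_intros h_lim reduced_cons_red g)
    \<comment> \<open>The translate of \<open>A\<close> by \<open>cons_red x g\<close> is the letter
      \<open>x\<close> applied to the translate by \<open>g\<close>, so the approximate stationarity
      applies to the latter set.\<close>
    moreover have "?e \<longlonglongrightarrow> 0"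
    proof (rule Lim_null_comparison)
      have "{cons_red x g} <#>\<^bsub>F2\<^esub> A = cons_red x ` ({g} <#>\<^bsub>F2\<^esub> A)" for x
        by (auto simp: set_mult_def F2_simps foldr_cons_red redA)
      moreover have "reduced w" if "w \<in> {g} <#>\<^bsub>F2\<^esub> A" for w
        using that by (auto simp: set_mult_def F2_simps reduced_foldr redA)
      ultimately show "\<forall>\<^sub>F n in sequentially. norm (?e n) \<le> 20 / real (r n)"
        using sum_mean_density_letter_translates[of "{g} <#>\<^bsub>F2\<^esub> A"] by simp
      have "filterlim (\<lambda>n. real (r n)) at_top sequentially"
        by (intro filterlim_compose[OF filterlim_real_sequentially] filterlim_subseq r)
      then show "(\<lambda>n. 20 / real (r n)) \<longlonglongrightarrow> 0"
        by (intro tendsto_divide_0[OF tendsto_const] filterlim_at_top_imp_at_infinity)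
    qed
    ultimately show ?thesis using LIMSEQ_unique by fastforce
  qed
  define d where "d = Sup (h ` carrier F2)"
  have bdd_h: "bdd_above (h ` carrier F2)"
    by (rule bdd_aboveI[of _ 1]) (auto simp: h_def intro: L_le_1)
  have h_le: "h g \<le> d" if "reduced g" for g
    unfolding d_def using that by (intro cSup_upper bdd_h) (auto simp: F2_simps)
  have "d > 0"
    using pos h_le[of "[]"] by (simp add: h_def F2_simps)
  define \<F> where "\<F> = {F. finite F \<and> F \<subseteq> carrier F2}"
  have bdd_L: "bdd_above (L ` \<F>)"
    by (rule bdd_aboveI[of _ 1]) (auto simp: \<F>_def intro: L_le_1)
  have "\<exists>F\<in>\<F>. Sup (L ` \<F>) - d / 2 < L F"
  proof -
    have "L ` \<F> \<noteq> {}" by (auto simp: \<F>_def)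
    then show ?thesis
      using less_cSup_iff[OF _ bdd_L, of "Sup (L ` \<F>) - d / 2"] \<open>d > 0\<close> by auto
  qed
  then obtain F where F: "finite F" "F \<subseteq> carrier F2" and F_max: "Sup (L ` \<F>) < L F + d / 2"
    by (auto simp: \<F>_def)
  have "\<exists>g\<in>carrier F2. K #>\<^bsub>F2\<^esub> g \<subseteq> F <#>\<^bsub>F2\<^esub> A <#>\<^bsub>F2\<^esub> set_inv\<^bsub>F2\<^esub> A"
    if K: "finite K" "K \<subseteq> carrier F2" for K
  proof -
    obtain N where N: "length k \<le> N" if "k \<in> K" for k
      using finite_nat_set_iff_bounded_le[of "length ` K"] K by auto
    \<comment> \<open>The tolerance is chosen so that the Harnack factor \<open>4 ^ N\<close> still
      leaves a defect below \<open>d / 2\<close> at every \<open>k g\<close>.\<close>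
    have "\<exists>g\<in>carrier F2. d - d / (2 * 4 ^ N) < h g"
      using less_cSup_iff[OF _ bdd_h, of "d - d / (2 * 4 ^ N)"] \<open>d > 0\<close> one_closed
      by (auto simp: d_def[symmetric])
    then obtain g where g: "reduced g" "4 ^ N * (d - h g) < d / 2"
      by (auto simp: F2_simps field_simps)
    have "k \<otimes>\<^bsub>F2\<^esub> g \<in> F <#>\<^bsub>F2\<^esub> A <#>\<^bsub>F2\<^esub> set_inv\<^bsub>F2\<^esub> A" if k: "k \<in> K" for k
    proof -
      define v where "v = k \<otimes>\<^bsub>F2\<^esub> g"
      have v: "v \<in> carrier F2" using K g k by (auto simp: v_def F2_simps reduced_foldr)
      have "d - h v \<le> 4 ^ length k * (d - h g)"
        unfolding v_def F2_simps by (rule harmonic_near_supremum[OF harmonic h_le g(1)])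
      also have "\<dots> \<le> 4 ^ N * (d - h g)"
        using N[OF k] h_le[OF g(1)] by (intro mult_right_mono power_increasing) auto
      finally have hv: "h v > d / 2" using g(2) by linarith
      have "(F <#>\<^bsub>F2\<^esub> A) \<inter> ({v} <#>\<^bsub>F2\<^esub> A) \<noteq> {}"
      proof
        assume disj: "(F <#>\<^bsub>F2\<^esub> A) \<inter> ({v} <#>\<^bsub>F2\<^esub> A) = {}"
        have "insert v F <#>\<^bsub>F2\<^esub> A = (F <#>\<^bsub>F2\<^esub> A) \<union> ({v} <#>\<^bsub>F2\<^esub> A)"
          by (auto simp: set_mult_def)
        then have "(\<lambda>n. mean_density (r n) (insert v F <#>\<^bsub>F2\<^esub> A)) \<longlonglongrightarrow> L F + h v"
          using v by (auto simp: mean_density_disjoint_Un[OF disj] F2_simps intro!: tendsto_add lim F h_lim)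
        moreover have "(\<lambda>n. mean_density (r n) (insert v F <#>\<^bsub>F2\<^esub> A)) \<longlonglongrightarrow> L (insert v F)"
          using F v by (intro lim) auto
        ultimately have "L (insert v F) = L F + h v" using LIMSEQ_unique by blast
        moreover have "L (insert v F) \<le> Sup (L ` \<F>)"
          using F v by (intro cSup_upper bdd_L) (auto simp: \<F>_def)
        ultimately show False using F_max hv by linarith
      qed
      then obtain f a a' where fa: "f \<in> F" "a \<in> A" "a' \<in> A" "f \<otimes>\<^bsub>F2\<^esub> a = v \<otimes>\<^bsub>F2\<^esub> a'"
        by (auto simp: set_mult_def) metis
      then have "f \<otimes>\<^bsub>F2\<^esub> a \<otimes>\<^bsub>F2\<^esub> inv\<^bsub>F2\<^esub> a' = v"
        using A v by (metis inv_solve_right m_closed subsetD F(2))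
      then show ?thesis
        using fa unfolding v_def[symmetric] set_mult_def SET_INV_def by blast
    qed
    then show ?thesis
      using g(1) by (intro bexI[of _ g]) (auto simp: r_coset_def F2_simps(1))
  qed
  then show ?thesis using F by blast
qed

section \<open>Choice of the convergent subsequence\<close>

theorem theorem5p2:
  fixes A :: "letter list set"
  assumes "A \<subseteq> carrier F2"
    and "limsup (\<lambda>m. ereal (1 / real m *
           (\<Sum>n=1..m. real (card (A \<inter> word_sphere n)) / real (card (word_sphere n))))) > 0"
  shows "\<exists>F. finite F \<and> F \<subseteq> carrier F2 \<and>
           (\<forall>K. finite K \<and> K \<subseteq> carrier F2 \<longrightarrow>
             (\<exists>g\<in>carrier F2. K #>\<^bsub>F2\<^esub> g \<subseteq> F <#>\<^bsub>F2\<^esub> A <#>\<^bsub>F2\<^esub> set_inv\<^bsub>F2\<^esub> A))"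
proof -
  interpret group F2 by (rule F2_group)
  let ?u = "\<lambda>m. ereal (mean_density m A)"
  have pos: "limsup ?u > 0"
    using assms(2) by (simp add: mean_density_def sphere_density_def)
  \<comment> \<open>The upper limit is realised first; refining \<open>r\<close> later preserves
    this limit, which makes the limit density of \<open>A\<close> positive.\<close>
  obtain r where r: "strict_mono r" "(?u \<circ> r) \<longlonglongrightarrow> limsup ?u"
    using limsup_subseq_lim[of ?u] by blast
  let ?\<F> = "{F. finite F \<and> F \<subseteq> carrier F2}"
  \<comment> \<open>Countability of the family of finite sets, with all averages in [0, 1], permits
    a diagonal argument: one subsequence works for every \<open>F\<close>.\<close>
  have "countable ?\<F>"
    by (intro countable_Collect_finite_subset countable_words)
  then obtain s where s: "strict_mono s"
    and conv: "\<And>F. F \<in> ?\<F> \<Longrightarrow> \<exists>l. (\<lambda>n. mean_density (r (s n)) (F <#>\<^bsub>F2\<^esub> A)) \<longlonglongrightarrow> l"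
    by (rule function_convergent_subsequence[of ?\<F> "\<lambda>n F. mean_density (r n) (F <#>\<^bsub>F2\<^esub> A)" 1])
       (auto simp: mean_density_nonneg mean_density_le_1)
  from conv obtain L where L: "\<And>F. finite F \<Longrightarrow> F \<subseteq> carrier F2 \<Longrightarrow>
      (\<lambda>n. mean_density ((r \<circ> s) n) (F <#>\<^bsub>F2\<^esub> A)) \<longlonglongrightarrow> L F"
    by (simp add: o_def) metis
  have "{\<one>\<^bsub>F2\<^esub>} <#>\<^bsub>F2\<^esub> A = A"
    using assms(1) by (auto simp: set_mult_def F2_simps)
  then have "(\<lambda>n. ereal (mean_density (r (s n)) A)) \<longlonglongrightarrow> ereal (L {\<one>\<^bsub>F2\<^esub>})"
    using L[of "{\<one>\<^bsub>F2\<^esub>}"] by simp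
  moreover have "(\<lambda>n. ereal (mean_density (r (s n)) A)) \<longlonglongrightarrow> limsup ?u"
    using LIMSEQ_subseq_LIMSEQ[OF r(2) s] by (simp add: o_def)
  ultimately have "limsup ?u = ereal (L {\<one>\<^bsub>F2\<^esub>})"
    by (rule LIMSEQ_unique[symmetric])
  with pos have "L {\<one>\<^bsub>F2\<^esub>} > 0" by simp
  then show ?thesis
    using thick_product_of_limit_density[OF assms(1) strict_mono_o[OF r(1) s] L] by blast
qed

end
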